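(* Let $\lambda\in\mathbb{C}_p$ with $\lambda\ne0$ and $|\lambda|_p\le1$ ($p$ an odd prime), let $r\in\mathbb{N}$ and let $k$ be an integer with $0\le k\le r$. For every $n\ge0$, \[ Ch^{(r)}_{n,\lambda}(x)=\sum_{l=0}^n\binom{n}{l}Ch^{(k)}_{l,\lambda}\,Ch^{(r-k)}_{n-l,\lambda}(x). \]
   Context: Write $(x)_{0,\lambda}=1$, $(x)_{n,\lambda}=x(x-\lambda)\cdots(x-(n-1)\lambda)$, and $(1+\lambda u)^{x/\lambda}=\sum_{m\ge0}(x)_{m,\lambda}u^m/m!$. For an integer $s\ge0$, the higher-order degenerate Changhee polynomials of the second kind are defined by $\left(\frac{2}{1+(1+\lambda\log(1+t))^{1/\lambda}}\right)^s(1+\lambda\log(1+t))^{x/\lambda}=\sum_{n\ge0}Ch^{(s)}_{n,\lambda}(x)\frac{t^n}{n!}$, and $Ch^{(s)}_{n,\lambda}=Ch^{(s)}_{n,\lambda}(0)$. *)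

theory Defs
  imports "HOL-Computational_Algebra.Computational_Algebra"
begin

text \<open>
  A model of \<open>\<complex>\<^sub>p\<close>: the completion of an algebraic closure of \<open>\<rat>\<^sub>p\<close>, where \<open>\<rat>\<^sub>p\<close> is the completion
  of \<open>\<rat>\<close> for the \<open>p\<close>-adic absolute value with \<open>\<bar>p\<bar> = 1/p\<close>.  The ambient field is complete, so the
  two completions are closures in it.  These axioms determine \<open>\<complex>\<^sub>p\<close> up to isometric isomorphism.
  On \<open>\<rat>\<close> the absolute value is the \<open>p\<close>-adic one: the ultrametric inequality and Bezout force
  \<open>\<bar>m\<bar> = 1\<close> for every integer \<open>m\<close> prime to \<open>p\<close>.
\<close>

definition nrm_closure :: "('a::ab_group_add \<Rightarrow> real) \<Rightarrow> 'a set \<Rightarrow> 'a set" where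
  "nrm_closure nrm S = {x. \<forall>e>0. \<exists>y\<in>S. nrm (x - y) < e}"

definition padic_field :: "('a::field_char_0 \<Rightarrow> real) \<Rightarrow> 'a set" where
  "padic_field nrm = nrm_closure nrm \<rat>"

definition padic_algebraic :: "('a::field_char_0 \<Rightarrow> real) \<Rightarrow> 'a set" where
  "padic_algebraic nrm =
     {x. \<exists>f. f \<noteq> 0 \<and> (\<forall>i. coeff f i \<in> padic_field nrm) \<and> poly f x = 0}"

locale padic_complex_numbers =
  fixes p :: nat and nrm :: "'a::field_char_0 \<Rightarrow> real"
  assumes prime_p: "prime p"
    and nrm_nonneg: "\<And>x. nrm x \<ge> 0"
    and nrm_eq_0_iff: "\<And>x. nrm x = 0 \<longleftrightarrow> x = 0"
    and nrm_mult: "\<And>x y. nrm (x * y) = nrm x * nrm y"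
    and nrm_ultrametric: "\<And>x y. nrm (x + y) \<le> max (nrm x) (nrm y)"
    and nrm_p: "nrm (of_nat p) = 1 / real p"
    and complete: "\<And>X :: nat \<Rightarrow> 'a.
          (\<forall>e>0. \<exists>N. \<forall>m\<ge>N. \<forall>n\<ge>N. nrm (X m - X n) < e) \<Longrightarrow>
          \<exists>L. (\<lambda>n. nrm (X n - L)) \<longlonglongrightarrow> 0"
    and algebraically_closed: "\<And>f :: 'a poly.
          (\<forall>i. coeff f i \<in> padic_algebraic nrm) \<Longrightarrow> degree f > 0 \<Longrightarrow>
          \<exists>x\<in>padic_algebraic nrm. poly f x = 0"
    and dense: "nrm_closure nrm (padic_algebraic nrm) = UNIV"

definition degen_falling :: "'a::comm_ring_1 \<Rightarrow> 'a \<Rightarrow> nat \<Rightarrow> 'a" where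
  "degen_falling lam x n = (\<Prod>i<n. x - of_nat i * lam)"

text \<open>The formal power series \<open>(1 + \<lambda>u)\<^bsup>x/\<lambda>\<^esup>\<close> in \<open>u\<close>, for a scalar \<open>x\<close> and for an indeterminate \<open>x\<close>.\<close>

definition degen_exp :: "'a::field_char_0 \<Rightarrow> 'a \<Rightarrow> 'a fps" where
  "degen_exp lam x = Abs_fps (\<lambda>m. degen_falling lam x m / fact m)"

definition degen_exp_poly :: "'a::field_char_0 \<Rightarrow> 'a poly fps" where
  "degen_exp_poly lam =
     Abs_fps (\<lambda>m. smult (1 / fact m) (degen_falling [:lam:] [:0, 1:] m))"

text \<open>The embedding of \<open>K[[t]]\<close> into \<open>K[x][[t]]\<close>.\<close>

definition fps_const_coeffs :: "'a::comm_ring_1 fps \<Rightarrow> 'a poly fps" where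
  "fps_const_coeffs f = Abs_fps (\<lambda>n. [:fps_nth f n:])"

text \<open>Here \<^term>\<open>fps_ln 1\<close> is the series \<open>log (1 + t)\<close>, and composing with it substitutes it for \<open>u\<close>.\<close>

definition degen_changhee_factor :: "'a::field_char_0 \<Rightarrow> 'a fps" where
  "degen_changhee_factor lam = 2 / (1 + (degen_exp lam 1 oo fps_ln 1))"

definition degen_changhee_gf :: "'a::field_char_0 \<Rightarrow> nat \<Rightarrow> 'a poly fps" where
  "degen_changhee_gf lam s =
     fps_const_coeffs (degen_changhee_factor lam ^ s) *
     (degen_exp_poly lam oo fps_const_coeffs (fps_ln 1))"

definition degen_changhee_poly :: "'a::field_char_0 \<Rightarrow> nat \<Rightarrow> nat \<Rightarrow> 'a poly" where
  "degen_changhee_poly lam s n = smult (fact n) (fps_nth (degen_changhee_gf lam s) n)"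

definition degen_changhee_number :: "'a::field_char_0 \<Rightarrow> nat \<Rightarrow> nat \<Rightarrow> 'a" where
  "degen_changhee_number lam s n = poly (degen_changhee_poly lam s n) 0"

text \<open>The generating function with a scalar substituted for the indeterminate.\<close>

lemma poly_degen_falling:
  "poly (degen_falling [:lam:] [:0, 1:] n) x = degen_falling lam (x :: 'a::field_char_0) n"
  by (simp add: degen_falling_def poly_prod of_nat_poly mult.commute)

lemma fps_const_coeffs_power: "fps_const_coeffs f ^ n = fps_const_coeffs (f ^ n)"
proof (induction n)
  case 0
  show ?case by (rule fps_ext) (simp add: fps_const_coeffs_def one_pCons fps_one_nth)
next
  case (Suc n)
  have *: "(\<Sum>i=0..m. [:fps_nth f i * fps_nth (f ^ n) (m - i):]) = 
        [:\<Sum>i=0..m. fps_nth f i * fps_nth (f ^ n) (m - i):]" for m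
    by (rule poly_eqI) (auto simp: coeff_sum coeff_pCons split: nat.splits)
  show ?case
    unfolding power_Suc Suc by (rule fps_ext) (simp add: fps_mult_nth fps_const_coeffs_def * mult.commute)
qed

lemma degen_changhee_poly_eval:
  fixes x :: "'a::field_char_0"
  shows "Abs_fps (\<lambda>n. poly (degen_changhee_poly lam s n) x / fact n) =
    (2 / (1 + (degen_exp lam 1 oo fps_ln 1))) ^ s * (degen_exp lam x oo fps_ln 1)"
  by (rule fps_ext)
     (simp add: degen_changhee_poly_def degen_changhee_gf_def degen_changhee_factor_def
        fps_mult_nth fps_compose_nth poly_sum fps_const_coeffs_power,
      simp add: fps_const_coeffs_def degen_exp_poly_def degen_exp_def poly_degen_falling)

end

theory Submission
  imports Defs
begin

text \<open>The order enters the generating function only as the exponent of a series free of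
  \<open>x\<close>, so the series of order \<open>r\<close> is the \<open>k\<close>-th power of that
  factor times the series of order \<open>r - k\<close> (\<open>degen_changhee_gf_add\<close>).
  Setting \<open>x = 0\<close> turns the exponential part into 1, so this power generates the
  numbers of order \<open>k\<close> (\<open>degen_changhee_number_eq\<close>). The identity is then
  the Cauchy product of two exponential generating functions.\<close>

lemma fps_const_coeffs_mult: "fps_const_coeffs (f * g) = fps_const_coeffs f * fps_const_coeffs g"
proof (rule fps_ext)
  fix n
  have "[:\<Sum>i\<in>A. h i:] = (\<Sum>i\<in>A. [:h i:])" for h :: "nat \<Rightarrow> 'a" and A
    by (rule poly_eqI) (auto simp: coeff_sum coeff_pCons split: nat.splits)
  then show "fps_nth (fps_const_coeffs (f * g)) n = fps_nth (fps_const_coeffs f * fps_const_coeffs g) n"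
    by (simp add: fps_const_coeffs_def fps_mult_nth mult.commute)
qed

lemma degen_exp_0: "degen_exp lam 0 = 1"
proof (rule fps_ext)
  fix n
  show "fps_nth (degen_exp lam 0) n = fps_nth 1 n"
    \<comment> \<open>For positive \<open>n\<close> the factor at \<open>i = 0\<close> vanishes; the
      shift splits off this first factor instead of the last.\<close>
    by (cases n) (simp_all add: degen_exp_def degen_falling_def prod.lessThan_Suc_shift del: prod.lessThan_Suc)
qed

text \<open>At \<open>x = 0\<close> only the power of the factor survives, since
  \<open>degen_exp lam 0\<close> is 1.\<close>

lemma degen_changhee_number_eq:
  "degen_changhee_number lam s n = fact n * fps_nth (degen_changhee_factor lam ^ s) n"
proof -
  have "fps_nth (Abs_fps (\<lambda>n. poly (degen_changhee_poly lam s n) 0 / fact n)) n =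
      fps_nth (degen_changhee_factor lam ^ s) n"
    by (simp only: degen_changhee_poly_eval degen_exp_0 fps_compose_1 mult_1_right
        flip: degen_changhee_factor_def)
  then show ?thesis
    by (simp add: degen_changhee_number_def field_simps)
qed

lemma degen_changhee_gf_add:
  "degen_changhee_gf lam (a + b) =
    fps_const_coeffs (degen_changhee_factor lam ^ a) * degen_changhee_gf lam b"
  by (simp add: degen_changhee_gf_def power_add fps_const_coeffs_mult mult.assoc)

theorem theorem2p13:
  fixes p :: nat and nrm :: "'a::field_char_0 \<Rightarrow> real" and lam :: 'a and r k n :: nat
  assumes "padic_complex_numbers p nrm" and "odd p"
    and "lam \<noteq> 0" and "nrm lam \<le> 1"
    and "k \<le> r"
  shows "degen_changhee_poly lam r n =
    (\<Sum>l=0..n. smult (of_nat (n choose l) * degen_changhee_number lam k l)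
       (degen_changhee_poly lam (r - k) (n - l)))"
proof -
  have "degen_changhee_poly lam r n = smult (fact n)
      (\<Sum>l=0..n. smult (fps_nth (degen_changhee_factor lam ^ k) l)
        (fps_nth (degen_changhee_gf lam (r - k)) (n - l)))"
    \<comment> \<open>By \<open>k \<le> r\<close> the truncated difference satisfies
      \<open>k + (r - k) = r\<close>.\<close>
    using degen_changhee_gf_add[of lam k "r - k"] \<open>k \<le> r\<close>
    by (simp add: degen_changhee_poly_def fps_mult_nth fps_const_coeffs_def)
  also have "\<dots> = (\<Sum>l=0..n. smult (of_nat (n choose l) * degen_changhee_number lam k l)
       (degen_changhee_poly lam (r - k) (n - l)))"
    \<comment> \<open>Compared coefficientwise in \<open>x\<close>, the terms agree because
      \<open>n! = (n choose l) * l! * (n - l)!\<close> for \<open>l \<le> n\<close>.\<close>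
    by (rule poly_eqI) (simp add: coeff_sum sum_distrib_left degen_changhee_number_eq
        degen_changhee_poly_def binomial_fact field_simps)
  finally show ?thesis .
qed

end
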